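(* Let $t\geq 2$ be an integer. There is a constant $D_t>0$ such that for every $n$ there is a $t$-program $P$ with $n$ atoms having at least $D_t\binom{2t-1}{t}^{n/(2t-1)}$ stable models.
   Context: A clause is $p\leftarrow B$ or $\leftarrow B$ (a constraint), where $p$ is an atom and $B$ is a finite set of literals (atoms $a$ or negated atoms $\mathrm{not}(a)$). A propositional logic program is a finite set of clauses; it is a $t$-program if every clause has at most $t$ literals, counting the head. $M\subseteq\mathit{At}(P)$ (the set of atoms of $P$) is a stable model of $P$ if $M$ satisfies all constraints of $P$ and is the least model of the Gelfond–Lifschitz reduct $P^M$, obtained by deleting every non-constraint clause with some $\mathrm{not}(a)$, $a\in M$, in its body and deleting negated literals from the remaining non-constraint clauses. *)

theory Defs
  imports Complex_Main
begin

datatype 'a literal = Pos 'a | Neg 'a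

datatype 'a clause =
    Rule 'a "'a literal set"
  | Constraint "'a literal set"

fun body :: "'a clause \<Rightarrow> 'a literal set" where
  "body (Rule p B) = B"
| "body (Constraint B) = B"

fun num_literals :: "'a clause \<Rightarrow> nat" where
  "num_literals (Rule p B) = Suc (card B)"
| "num_literals (Constraint B) = card B"

definition logic_program :: "'a clause set \<Rightarrow> bool" where
  "logic_program P \<longleftrightarrow> finite P \<and> (\<forall>c\<in>P. finite (body c))"

definition t_program :: "nat \<Rightarrow> 'a clause set \<Rightarrow> bool" where
  "t_program t P \<longleftrightarrow> logic_program P \<and> (\<forall>c\<in>P. num_literals c \<le> t)"

fun literal_atom :: "'a literal \<Rightarrow> 'a" where
  "literal_atom (Pos a) = a"
| "literal_atom (Neg a) = a"

fun clause_atoms :: "'a clause \<Rightarrow> 'a set" where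
  "clause_atoms (Rule p B) = insert p (literal_atom ` B)"
| "clause_atoms (Constraint B) = literal_atom ` B"

definition program_atoms :: "'a clause set \<Rightarrow> 'a set" where
  "program_atoms P = (\<Union>c\<in>P. clause_atoms c)"

fun sat_literal :: "'a set \<Rightarrow> 'a literal \<Rightarrow> bool" where
  "sat_literal M (Pos a) \<longleftrightarrow> a \<in> M"
| "sat_literal M (Neg a) \<longleftrightarrow> a \<notin> M"

fun sat_clause :: "'a set \<Rightarrow> 'a clause \<Rightarrow> bool" where
  "sat_clause M (Rule p B) \<longleftrightarrow> ((\<forall>l\<in>B. sat_literal M l) \<longrightarrow> p \<in> M)"
| "sat_clause M (Constraint B) \<longleftrightarrow> \<not> (\<forall>l\<in>B. sat_literal M l)"

definition is_model :: "'a clause set \<Rightarrow> 'a set \<Rightarrow> bool" where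
  "is_model P M \<longleftrightarrow> (\<forall>c\<in>P. sat_clause M c)"

definition least_model :: "'a clause set \<Rightarrow> 'a set \<Rightarrow> bool" where
  "least_model P M \<longleftrightarrow> is_model P M \<and> (\<forall>N. is_model P N \<longrightarrow> M \<subseteq> N)"

text \<open>The Gelfond--Lifschitz reduct contains no constraints: these are only required to hold
  in the candidate model itself and take no part in its derivation.\<close>

definition reduct :: "'a clause set \<Rightarrow> 'a set \<Rightarrow> 'a clause set" where
  "reduct P M =
     {Rule p {l \<in> B. \<exists>a. l = Pos a} | p B. Rule p B \<in> P \<and> \<not> (\<exists>a\<in>M. Neg a \<in> B)}"

definition stable_model :: "'a clause set \<Rightarrow> 'a set \<Rightarrow> bool" where
  "stable_model P M \<longleftrightarrow>
     M \<subseteq> program_atoms P \<and>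
     (\<forall>B. Constraint B \<in> P \<longrightarrow> sat_clause M (Constraint B)) \<and>
     least_model (reduct P M) M"

end

theory Submission
  imports Defs "HOL-Library.FuncSet"
begin

text \<open>Split the atoms into blocks of \<open>2 * t - 1\<close> atoms and, inside each block, let every atom
  be derived from the absence of any \<open>t - 1\<close> others. If \<open>M\<close> meets a block in exactly \<open>t\<close> atoms,
  then the only \<open>(t - 1)\<close>-subset of the block missed by \<open>M\<close> is its complement, which derives
  precisely the atoms of \<open>M\<close>. So the \<open>t\<close>-subsets of the blocks can be chosen independently; the
  fewer than \<open>2 * t - 1\<close> atoms left over are made facts, which costs only a constant factor.\<close>

section \<open>Programs with purely negative bodies\<close>

definition negative_program :: "('a \<times> 'a set) set \<Rightarrow> 'a clause set" where
  "negative_program R = (\<lambda>(a, B). Rule a (Neg ` B)) ` R"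

lemma negative_program_rule_iff:
  fixes a :: 'a
  shows "Rule a (Neg ` B) \<in> negative_program R \<longleftrightarrow> (a, B) \<in> R"
proof -
  have "inj (Neg :: 'a \<Rightarrow> 'a literal)"
    by (simp add: inj_def)
  then have "Neg ` B' = Neg ` B \<longleftrightarrow> B' = B" for B' :: "'a set"
    by (rule inj_image_eq_iff)
  then show ?thesis
    by (force simp: negative_program_def)
qed

text \<open>All body literals are negated, so a rule that survives the reduct loses its whole body
  and becomes a fact.\<close>

lemma reduct_negative_program:
  "reduct (negative_program R) M = (\<lambda>a. Rule a {}) ` {a. \<exists>B. (a, B) \<in> R \<and> B \<inter> M = {}}"
  (is "?L = ?R")
proof (intro set_eqI iffI)
  fix c assume "c \<in> ?L"
  then obtain a L where c: "c = Rule a {l \<in> L. \<exists>b. l = Pos b}"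
    and L: "Rule a L \<in> negative_program R" "\<not> (\<exists>b\<in>M. Neg b \<in> L)"
    unfolding reduct_def by blast
  from L(1) obtain B where B: "L = Neg ` B" "(a, B) \<in> R"
    by (auto simp: negative_program_def)
  then have "c = Rule a {}" "B \<inter> M = {}"
    using c L(2) by auto
  then show "c \<in> ?R" using B(2) by blast
next
  fix c assume "c \<in> ?R"
  then obtain a B where c: "c = Rule a {}" and R: "(a, B) \<in> R" and B: "B \<inter> M = {}"
    by blast
  have "c = Rule a {l \<in> Neg ` B. \<exists>b. l = Pos b}" "\<not> (\<exists>b\<in>M. Neg b \<in> Neg ` B)"
    using c B by auto
  moreover have "Rule a (Neg ` B) \<in> negative_program R"
    using R by (simp only: negative_program_rule_iff)
  ultimately show "c \<in> ?L"
    unfolding reduct_def by blast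
qed

lemma program_atoms_negative_program:
  "program_atoms (negative_program R) = (\<Union>(a, B)\<in>R. insert a B)"
proof -
  have "clause_atoms (Rule a (Neg ` B)) = insert a B" for a :: 'a and B :: "'a set"
    by (simp add: image_image)
  then show ?thesis
    by (simp add: program_atoms_def negative_program_def case_prod_unfold del: clause_atoms.simps)
qed

text \<open>The reduct is a set of facts, whose least model is the set of their heads. Stability
  thus becomes a fixed-point equation, and least models need not be considered again.\<close>

lemma stable_model_negative_program:
  "stable_model (negative_program R) M \<longleftrightarrow> M = {a. \<exists>B. (a, B) \<in> R \<and> B \<inter> M = {}}"
proof -
  let ?H = "{a. \<exists>B. (a, B) \<in> R \<and> B \<inter> M = {}}"
  have model: "is_model (reduct (negative_program R) M) N \<longleftrightarrow> ?H \<subseteq> N" for N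
    by (auto simp: is_model_def reduct_negative_program)
  have "least_model (reduct (negative_program R) M) M \<longleftrightarrow> M = ?H"
    unfolding least_model_def model by blast
  moreover have "?H \<subseteq> program_atoms (negative_program R)"
    by (auto simp: program_atoms_negative_program)
  moreover have "Constraint B \<notin> negative_program R" for B
    by (auto simp: negative_program_def)
  ultimately show ?thesis
    by (auto simp: stable_model_def)
qed

lemma t_program_negative_program:
  assumes "finite R" "\<And>a B. (a, B) \<in> R \<Longrightarrow> finite B \<and> card B < t"
  shows "t_program t (negative_program R)"
  using assms
  by (auto simp: t_program_def logic_program_def negative_program_def card_image inj_on_def
      Suc_le_eq)

section \<open>Blocks of consecutive numbers and the program built on them\<close>

definition block :: "nat \<Rightarrow> nat \<Rightarrow> nat set" where
  "block m i = {i * m..<i * m + m}"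

lemma finite_block [simp]: "finite (block m i)"
  by (simp add: block_def)

lemma card_block [simp]: "card (block m i) = m"
  by (simp add: block_def)

text \<open>The quotient names the one block that contains \<open>a\<close>; disjointness of the
  blocks follows from this.\<close>

lemma mem_block_iff:
  assumes "m > 0"
  shows "a \<in> block m i \<longleftrightarrow> a div m = i"
proof
  assume "a \<in> block m i"
  then show "a div m = i"
    by (intro div_nat_eqI) (auto simp: block_def mult.commute)
next
  assume "a div m = i"
  then show "a \<in> block m i"
    using assms div_mult_mod_eq[of a m] mod_less_divisor[of m a]
    unfolding block_def by (metis atLeastLessThan_iff le_add1 nat_add_left_cancel_less)
qed

text \<open>Bodies of size \<open>t - 1\<close> leave room for the head. Removing \<open>a\<close>
  from them is essential: otherwise the body formed by the block atoms outside \<open>M\<close>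
  would derive every atom of the block, not only those in \<open>M\<close>.\<close>

definition block_rules :: "nat \<Rightarrow> nat \<Rightarrow> nat \<Rightarrow> (nat \<times> nat set) set" where
  "block_rules t q n =
     {(a, B). a < q * (2 * t - 1) \<and>
        B \<subseteq> block (2 * t - 1) (a div (2 * t - 1)) - {a} \<and> card B = t - 1}
     \<union> {q * (2 * t - 1)..<n} \<times> {{}}"

lemma block_subset_lessThan:
  assumes "m > 0" "i < q"
  shows "block m i \<subseteq> {..<q * m}"
proof
  fix a assume "a \<in> block m i"
  then have "a div m < q" using assms by (simp add: mem_block_iff)
  then show "a \<in> {..<q * m}" using assms by (simp add: div_less_iff_less_mult)
qed

lemma block_rules_bounds:
  assumes "t > 0" "q * (2 * t - 1) \<le> n" "(a, B) \<in> block_rules t q n"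
  shows "a < n" "B \<subseteq> {..<n}" "card B < t"
proof -
  have "2 * t - 1 > 0" using assms by simp
  then have "a < q * (2 * t - 1) \<Longrightarrow>
      block (2 * t - 1) (a div (2 * t - 1)) \<subseteq> {..<q * (2 * t - 1)}"
    by (intro block_subset_lessThan) (auto simp: div_less_iff_less_mult)
  then show "a < n" "B \<subseteq> {..<n}" "card B < t"
    using assms by (fastforce simp: block_rules_def)+
qed

lemma t_program_block_rules:
  assumes "t > 0" "q * (2 * t - 1) \<le> n"
  shows "t_program t (negative_program (block_rules t q n))"
proof (rule t_program_negative_program)
  have "block_rules t q n \<subseteq> {..<n} \<times> Pow {..<n}"
    using block_rules_bounds(1,2)[OF assms] by (intro subrelI) simp
  then show "finite (block_rules t q n)"
    by (rule finite_subset) simp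
  show "finite B \<and> card B < t" if "(a, B) \<in> block_rules t q n" for a B
    using block_rules_bounds[OF assms that] finite_subset by blast
qed

text \<open>Every number below \<open>n\<close> heads some rule: a block without \<open>a\<close>
  has \<open>2 * t - 2\<close> elements, enough to contain a body of size
  \<open>t - 1\<close>.\<close>

lemma program_atoms_block_rules:
  assumes "t > 0" "q * (2 * t - 1) \<le> n"
  shows "program_atoms (negative_program (block_rules t q n)) = {..<n}"
proof
  show "program_atoms (negative_program (block_rules t q n)) \<subseteq> {..<n}"
    using block_rules_bounds[OF assms] unfolding program_atoms_negative_program by blast
  have "\<exists>B. (a, B) \<in> block_rules t q n" if "a < n" for a
  proof (cases "a < q * (2 * t - 1)")
    case True
    have "a \<in> block (2 * t - 1) (a div (2 * t - 1))"
      using assms by (simp add: mem_block_iff)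
    then have "t - 1 \<le> card (block (2 * t - 1) (a div (2 * t - 1)) - {a})"
      by simp
    then obtain B where "B \<subseteq> block (2 * t - 1) (a div (2 * t - 1)) - {a}" "card B = t - 1"
      by (rule obtain_subset_with_card_n)
    then show ?thesis
      using True unfolding block_rules_def by blast
  next
    case False
    then show ?thesis using that by (auto simp: block_rules_def)
  qed
  then show "{..<n} \<subseteq> program_atoms (negative_program (block_rules t q n))"
    by (fastforce simp: program_atoms_negative_program)
qed

section \<open>Stable models of the block program and their number\<close>

lemma stable_model_block_rules:
  assumes "t > 0" "q * (2 * t - 1) \<le> n"
    and "M \<subseteq> {..<n}" "{q * (2 * t - 1)..<n} \<subseteq> M"
    and card_M: "\<And>i. i < q \<Longrightarrow> card (M \<inter> block (2 * t - 1) i) = t"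
  shows "stable_model (negative_program (block_rules t q n)) M"
proof -
  let ?m = "2 * t - 1"
  \<comment> \<open>The block size is chosen for this: the complement of a \<open>t\<close>-subset
    has exactly the size of a body.\<close>
  have compl: "card (block ?m i - M) = t - 1" if "i < q" for i
    using card_M[OF that] card_Diff_subset_Int[of "block ?m i" M] by (simp add: Int_commute)
  have "a \<in> M \<longleftrightarrow> (\<exists>B. (a, B) \<in> block_rules t q n \<and> B \<inter> M = {})" for a
  proof (cases "a < q * ?m")
    case True
    let ?b = "block ?m (a div ?m)"
    have a: "a \<in> ?b" using assms(1) by (simp add: mem_block_iff)
    have i: "a div ?m < q" using True assms(1) by (simp add: div_less_iff_less_mult)
    have rule: "(a, B) \<in> block_rules t q n \<longleftrightarrow> B \<subseteq> ?b - {a} \<and> card B = t - 1" for B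
      using True by (auto simp: block_rules_def)
    show ?thesis
    proof
      assume "a \<in> M"
      then have "(a, ?b - M) \<in> block_rules t q n \<and> (?b - M) \<inter> M = {}"
        unfolding rule using compl[OF i] by blast
      then show "\<exists>B. (a, B) \<in> block_rules t q n \<and> B \<inter> M = {}" ..
    next
      assume "\<exists>B. (a, B) \<in> block_rules t q n \<and> B \<inter> M = {}"
      then obtain B where B: "B \<subseteq> ?b - {a}" "card B = t - 1" "B \<inter> M = {}"
        unfolding rule by blast
      \<comment> \<open>\<open>B\<close> lies inside \<open>?b - M\<close> and has the same finite
        size, so it fills it. As \<open>a\<close> is in \<open>?b\<close> but not in
        \<open>B\<close>, it must lie in \<open>M\<close>.\<close>
      then have "B = ?b - M"
        using compl[OF i] by (intro card_subset_eq) auto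
      then show "a \<in> M" using a B by blast
    qed
  next
    case False
    then show ?thesis using assms(3,4) by (fastforce simp: block_rules_def)
  qed
  then show ?thesis
    unfolding stable_model_negative_program by blast
qed

lemma card_stable_models_block_rules:
  assumes "t > 0" "q * (2 * t - 1) \<le> n"
  shows "((2 * t - 1) choose t) ^ q
           \<le> card {M. stable_model (negative_program (block_rules t q n)) M}"
proof -
  let ?m = "2 * t - 1"
  \<comment> \<open>One \<open>t\<close>-subset is chosen per block. \<open>PiE\<close> fixes the
    value outside \<open>{..<q}\<close>, so a choice function is determined by its \<open>q\<close>
    subsets and there are only finitely many.\<close>
  let ?F = "PiE {..<q} (\<lambda>i. {S. S \<subseteq> block ?m i \<and> card S = t})"
  let ?U = "\<lambda>f. (\<Union>i<q. f i) \<union> {q * ?m..<n}"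
  have m: "?m > 0" using assms by simp
  have sub: "f i \<subseteq> block ?m i" and card: "card (f i) = t" if "f \<in> ?F" "i < q" for f i
    using that by auto
  \<comment> \<open>Blocks are disjoint and the leftover atoms lie above all of them, so cutting
    with a block recovers the choice. This yields both injectivity of \<open>?U\<close> and the size
    condition for stability.\<close>
  have Int: "?U f \<inter> block ?m i = f i" if "f \<in> ?F" "i < q" for f i
  proof
    show "f i \<subseteq> ?U f \<inter> block ?m i"
      using that(2) sub[OF that] by blast
    show "?U f \<inter> block ?m i \<subseteq> f i"
    proof
      fix a assume a: "a \<in> ?U f \<inter> block ?m i"
      then have "a < q * ?m" using block_subset_lessThan[OF m \<open>i < q\<close>] by auto
      then obtain j where j: "j < q" "a \<in> f j" using a by auto
      then have "j = i" using a sub[OF that(1) j(1)] m by (auto simp: mem_block_iff)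
      then show "a \<in> f i" using j by simp
    qed
  qed
  have "inj_on ?U ?F"
  proof (rule inj_onI)
    fix f g assume fg: "f \<in> ?F" "g \<in> ?F" "?U f = ?U g"
    show "f = g"
    proof (rule PiE_ext[OF fg(1,2)])
      fix i assume "i \<in> {..<q}"
      then show "f i = g i"
        using Int[OF fg(1), of i] Int[OF fg(2), of i] fg(3) by simp
    qed
  qed
  then have "card (?U ` ?F) = (?m choose t) ^ q"
    by (simp add: card_image card_PiE n_subsets)
  moreover have "?U ` ?F \<subseteq> {M. stable_model (negative_program (block_rules t q n)) M}"
  proof clarify
    fix f assume f: "f \<in> ?F"
    have "f i \<subseteq> {..<q * ?m}" if "i < q" for i
      using sub[OF f that] block_subset_lessThan[OF m that] by (rule subset_trans)
    then have "?U f \<subseteq> {..<q * ?m} \<union> {..<n}"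
      by (intro Un_mono UN_least) auto
    then have "?U f \<subseteq> {..<n}"
      using assms(2) by (simp add: Un_absorb1)
    moreover have "card (?U f \<inter> block ?m i) = t" if "i < q" for i
      using Int[OF f that] card[OF f that] by (simp only:)
    ultimately show "stable_model (negative_program (block_rules t q n)) (?U f)"
      by (intro stable_model_block_rules[OF assms]) simp_all
  qed
  \<comment> \<open>\<open>card\<close> is 0 on infinite sets, so finiteness is required before the
    cardinalities can be compared.\<close>
  moreover have "finite {M. stable_model (negative_program (block_rules t q n)) M}"
  proof (rule finite_subset)
    show "{M. stable_model (negative_program (block_rules t q n)) M} \<subseteq> Pow {..<n}"
      using program_atoms_block_rules[OF assms] by (auto simp: stable_model_def)
  qed simp
  ultimately show ?thesis
    using card_mono[of "{M. stable_model (negative_program (block_rules t q n)) M}" "?U ` ?F"]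
    by simp
qed

theorem theorem4:
  fixes t :: nat
  assumes "t \<ge> 2"
  shows "\<exists>D::real. D > 0 \<and>
    (\<forall>n::nat. \<exists>P::nat clause set.
       t_program t P \<and> card (program_atoms P) = n \<and>
       real (card {M. stable_model P M}) \<ge>
         D * real ((2 * t - 1) choose t) powr (real n / real (2 * t - 1)))"
proof -
  define m where "m = 2 * t - 1"
  define C where "C = real (m choose t)"
  have t: "t > 0" and m: "m > 0" using assms by (auto simp: m_def)
  have "m choose t > 0" using t by (simp add: m_def)
  then have C: "C \<ge> 1" unfolding C_def by linarith
  \<comment> \<open>The factor \<open>1 / C\<close> pays for rounding \<open>n / m\<close> down to
    \<open>q\<close>: since \<open>n / m\<close> is at most \<open>q + 1\<close>, the loss is at
    most one factor \<open>C\<close>.\<close>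
  have "\<exists>P::nat clause set. t_program t P \<and> card (program_atoms P) = n \<and>
      real (card {M. stable_model P M}) \<ge> (1 / C) * C powr (real n / real m)" for n
  proof (intro exI conjI)
    define q where "q = n div m"
    let ?P = "negative_program (block_rules t q n)"
    have q: "q * (2 * t - 1) \<le> n" by (simp add: q_def m_def)
    show "t_program t ?P" using t q by (rule t_program_block_rules)
    show "card (program_atoms ?P) = n" by (simp add: program_atoms_block_rules[OF t q])
    have "n < Suc q * m"
      using m by (simp add: q_def dividend_less_div_times)
    then have "real n \<le> real (Suc q) * real m"
      by (metis of_nat_le_iff of_nat_mult less_imp_le)
    then have "real n / real m \<le> real (Suc q)"
      using m by (simp add: divide_le_eq)
    \<comment> \<open>Monotonicity in the exponent relies on \<open>C\<close> being at least
      1.\<close>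
    then have "C powr (real n / real m) \<le> C powr real (Suc q)"
      using C by (rule powr_mono)
    also have "\<dots> = C * C ^ q" using C by (simp add: powr_realpow del: of_nat_Suc)
    finally have "(1 / C) * C powr (real n / real m) \<le> C ^ q"
      using C by (simp add: field_simps)
    also have "\<dots> \<le> real (card {M. stable_model ?P M})"
      using card_stable_models_block_rules[OF t q]
      unfolding C_def m_def by (metis of_nat_le_iff of_nat_power)
    finally show "(1 / C) * C powr (real n / real m) \<le> real (card {M. stable_model ?P M})" .
  qed
  then show ?thesis
    using C unfolding C_def m_def by (intro exI[of _ "1 / real ((2 * t - 1) choose t)"]) auto
qed

end
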